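(* Let $A, B$ be open subsets of $[0,1]^3$ (open in the subspace topology) with $A \cup B = [0,1]^3$. Then at least one of the six sets $$ \Pi_{XY}(A),\ \Pi_{YZ}(A),\ \Pi_{XZ}(A),\ \Pi_{XY}(B),\ \Pi_{YZ}(B),\ \Pi_{XZ}(B)$$ has area (2-dimensional Lebesgue measure) at least $3/4$.
   Context: The maps $\Pi_{XY}, \Pi_{YZ}, \Pi_{XZ} : [0,1]^3 \to [0,1]^2$ are the coordinate projections $\Pi_{XY}(x,y,z) = (x,y)$, $\Pi_{YZ}(x,y,z) = (y,z)$, $\Pi_{XZ}(x,y,z)=(x,z)$, and $\Pi(A)$ denotes the image of the set $A$. *)

theory Defs
  imports "HOL-Analysis.Analysis"
begin

definition unit_cube :: "(real \<times> real \<times> real) set" where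
  "unit_cube = {0..1} \<times> {0..1} \<times> {0..1}"

definition Pi_XY :: "real \<times> real \<times> real \<Rightarrow> real \<times> real" where
  "Pi_XY = (\<lambda>(x, y, z). (x, y))"

definition Pi_YZ :: "real \<times> real \<times> real \<Rightarrow> real \<times> real" where
  "Pi_YZ = (\<lambda>(x, y, z). (y, z))"

definition Pi_XZ :: "real \<times> real \<times> real \<Rightarrow> real \<times> real" where
  "Pi_XZ = (\<lambda>(x, y, z). (x, z))"

text \<open>Images under these projections of relatively open subsets of the cube are relatively
  open in the unit square, hence Lebesgue measurable with finite measure. So the value of
  \<open>measure\<close> below is never the default value 0 for non-measurable sets or infinite measure.\<close>

abbreviation area :: "(real \<times> real) set \<Rightarrow> real" where
  "area S \<equiv> measure lebesgue S"

end

theory Submission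
  imports Defs
begin

text \<open>Suppose all six projections have area below 3/4. For each coordinate direction the lines
  of the cube missing A then form a compact subset of the unit square of area above 1/4, and
  likewise for B. Each of these six sets lies in the product of its two coordinate shadows, so the
  product of the twelve lengths of the shadows exceeds \<open>(1/4)^6\<close>. But a line missing A never meets
  a line missing B, because A and B cover the cube. So, for example, the x-shadow of the
  z-parallel lines missing A and the x-shadow of the y-parallel lines missing B are disjoint subsets
  of [0,1], and their lengths have product at most 1/4. The twelve shadows split into six such
  pairs, a contradiction.\<close>

definition unit_square :: "(real \<times> real) set" where
  "unit_square = {0..1} \<times> {0..1}"

text \<open>The map \<open>e q\<close> parametrizes the line over the base point \<open>q\<close>,
  so one definition serves all three directions and a line is recorded by its base point.\<close>

definition missing_lines ::
    "(real \<times> real \<Rightarrow> real \<Rightarrow> 'a) \<Rightarrow> 'a set \<Rightarrow> (real \<times> real) set" where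
  "missing_lines e A = {q \<in> unit_square. \<forall>t \<in> {0..1}. e q t \<notin> A}"

text \<open>Points \<open>e q t\<close> stay in \<open>K\<close>, so avoiding \<open>A\<close> means
  avoiding an open set. For fixed \<open>t\<close> this is a closed condition on \<open>q\<close>,
  and an intersection of closed conditions is closed. Compactness passes to the shadows, which are
  therefore measurable too.\<close>

lemma compact_missing_lines:
  fixes A K :: "'a::topological_space set"
  assumes A: "openin (top_of_set K) A"
    and cont: "\<And>t. continuous_on UNIV (\<lambda>q. e q t)"
    and K: "\<And>q t. q \<in> unit_square \<Longrightarrow> t \<in> {0..1} \<Longrightarrow> e q t \<in> K"
  shows "compact (missing_lines e A)"
proof -
  obtain T where T: "open T" "A = K \<inter> T"
    using A by (auto simp: openin_open)
  have eq: "missing_lines e A = unit_square \<inter> (\<Inter>t\<in>{0..1}. (\<lambda>q. e q t) -` (- T))"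
    using K T by (auto simp: missing_lines_def)
  have "closed (\<Inter>t\<in>{0..1}. (\<lambda>q. e q t) -` (- T))"
    using T cont by (intro closed_INT ballI closed_vimage) auto
  moreover have "compact unit_square"
    unfolding unit_square_def by (intro compact_Times compact_Icc)
  ultimately show ?thesis
    unfolding eq by (rule compact_Int_closed[rotated])
qed

lemma area_missing_lines:
  assumes "compact (missing_lines e A)"
  shows "area (missing_lines e A) = 1 - area {q \<in> unit_square. \<exists>t \<in> {0..1}. e q t \<in> A}"
proof -
  have cbox: "unit_square = cbox (0, 0) (1, 1)"
    by (simp add: unit_square_def cbox_Pair_eq)
  have sq: "unit_square \<in> lmeasurable"
    unfolding cbox by (rule lmeasurable_cbox)
  have area: "area unit_square = 1"
    unfolding cbox by (simp add: measure_completion content_Pair del: cbox_Pair_eq)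
  have "{q \<in> unit_square. \<exists>t \<in> {0..1}. e q t \<in> A} = unit_square - missing_lines e A"
    by (auto simp: missing_lines_def)
  moreover have "area (unit_square - missing_lines e A) = area unit_square - area (missing_lines e A)"
    using sq lmeasurable_compact[OF assms]
    by (intro measurable_measure_Diff) (auto simp: missing_lines_def fmeasurableD)
  ultimately show ?thesis
    using area by simp
qed

lemma area_le_shadows:
  fixes P :: "(real \<times> real) set"
  assumes "compact P"
  shows "area P \<le> measure lebesgue (fst ` P) * measure lebesgue (snd ` P)"
proof -
  have c: "compact (fst ` P)" "compact (snd ` P)"
    using assms by (auto intro!: compact_continuous_image continuous_intros)
  then have b: "fst ` P \<in> sets borel" "snd ` P \<in> sets borel"
    by (auto intro: borel_compact)
  have "area P \<le> area (fst ` P \<times> snd ` P)"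
    using c assms
    by (intro measure_mono_fmeasurable lmeasurable_compact compact_Times)
       (auto simp: fmeasurableD lmeasurable_compact image_iff, force+)
  \<comment> \<open>The detour through \<open>lborel\<close> is there because \<open>lborel\<close>
    on the plane is a product measure; on Borel sets it agrees with \<open>lebesgue\<close>.\<close>
  also have "\<dots> = measure lborel (fst ` P \<times> snd ` P)"
    using c by (intro measure_completion) (auto intro!: borel_compact compact_Times)
  also have "\<dots> = measure (lborel \<Otimes>\<^sub>M lborel) (fst ` P \<times> snd ` P)"
    by (simp add: lborel_prod)
  also have "\<dots> = measure lborel (fst ` P) * measure lborel (snd ` P)"
    using b by (simp add: measure_def lborel.emeasure_pair_measure_Times enn2real_mult)
  also have "\<dots> = measure lebesgue (fst ` P) * measure lebesgue (snd ` P)"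
    using b by (simp add: measure_completion)
  finally show ?thesis .
qed

text \<open>Disjointness inside an interval of length 1 gives \<open>?c + ?d \<le> 1\<close>, and by
  AM-GM \<open>4 * ?c * ?d\<close> is at most the square of that sum.\<close>

lemma measure_mult_disjoint_le:
  fixes C D :: "real set"
  assumes "compact C" "compact D" "C \<subseteq> {0..1}" "D \<subseteq> {0..1}" "C \<inter> D = {}"
  shows "measure lebesgue C * measure lebesgue D \<le> 1 / 4"
proof -
  let ?c = "measure lebesgue C" and ?d = "measure lebesgue D"
  have "?c + ?d = measure lebesgue (C \<union> D)"
    using assms by (intro measure_Un_AE[symmetric] lmeasurable_compact) auto
  also have "\<dots> \<le> measure lebesgue {0..1::real}"
    using assms by (intro measure_mono_fmeasurable) (auto simp: fmeasurableD lmeasurable_compact)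
  finally have "?c + ?d \<le> 1"
    by simp
  then have "(?c + ?d)\<^sup>2 \<le> 1"
    by (simp add: power_le_one)
  with sum_squares_bound[of ?c ?d] show ?thesis
    by (simp add: power2_sum)
qed

theorem corollary1:
  fixes A B :: "(real \<times> real \<times> real) set"
  assumes "openin (top_of_set unit_cube) A"
    and "openin (top_of_set unit_cube) B"
    and "A \<union> B = unit_cube"
  shows "\<exists>S \<in> {Pi_XY ` A, Pi_YZ ` A, Pi_XZ ` A, Pi_XY ` B, Pi_YZ ` B, Pi_XZ ` B}. area S \<ge> 3 / 4"
proof (rule ccontr)
  assume neg: "\<not> ?thesis"
  \<comment> \<open>Each map inserts the coordinate that the projection of the same name
    forgets.\<close>
  define exy where "exy = (\<lambda>(x::real, y::real) z::real. (x, y, z))"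
  define eyz where "eyz = (\<lambda>(y::real, z::real) x::real. (x, y, z))"
  define exz where "exz = (\<lambda>(x::real, z::real) y::real. (x, y, z))"
  note e_defs = exy_def eyz_def exz_def
  have compact: "compact (missing_lines exy C)" "compact (missing_lines eyz C)"
      "compact (missing_lines exz C)" if "openin (top_of_set unit_cube) C" for C
    by (rule compact_missing_lines[OF that];
        auto simp: e_defs case_prod_unfold unit_square_def unit_cube_def
             intro!: continuous_intros)+
  have image: "Pi_XY ` C = {q \<in> unit_square. \<exists>t \<in> {0..1}. exy q t \<in> C}"
      "Pi_YZ ` C = {q \<in> unit_square. \<exists>t \<in> {0..1}. eyz q t \<in> C}"
      "Pi_XZ ` C = {q \<in> unit_square. \<exists>t \<in> {0..1}. exz q t \<in> C}"
    if "C \<subseteq> unit_cube" for C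
    using that
    by (force simp: e_defs Pi_XY_def Pi_YZ_def Pi_XZ_def unit_square_def unit_cube_def image_iff)+
  \<comment> \<open>These are the lengths of the first and second shadow, not tied to the axes: for
    \<open>eyz\<close> the first shadow lies on the y-axis and the second on the z-axis.\<close>
  define x y where "x P = measure lebesgue (fst ` P)" and "y P = measure lebesgue (snd ` P)"
    for P :: "(real \<times> real) set"
  have big: "1 / 4 < x (missing_lines e C) * y (missing_lines e C)"
    if "e \<in> {exy, eyz, exz}" "C \<in> {A, B}" for e C
  proof -
    have C: "openin (top_of_set unit_cube) C" "C \<subseteq> unit_cube"
      using that assms by auto
    have cpt: "compact (missing_lines e C)"
      using that compact[OF C(1)] by auto
    \<comment> \<open>This set is a projection of \<open>A\<close> or \<open>B\<close>; its
      complement in the square, the missing lines, thus has area above 1/4.\<close>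
    have "area {q \<in> unit_square. \<exists>t \<in> {0..1}. e q t \<in> C} < 3 / 4"
      using that neg image[OF C(2)] by auto
    then show ?thesis
      using area_missing_lines[OF cpt] area_le_shadows[OF cpt] by (simp add: x_def y_def)
  qed
  have small: "measure lebesgue (f ` P) * measure lebesgue (g ` Q) \<le> 1 / 4"
    if "P \<in> {missing_lines exy A, missing_lines eyz A, missing_lines exz A}"
      "Q \<in> {missing_lines exy B, missing_lines eyz B, missing_lines exz B}"
      "f \<in> {fst, snd}" "g \<in> {fst, snd}" "f ` P \<inter> g ` Q = {}"
    for P Q and f g :: "real \<times> real \<Rightarrow> real"
  proof (rule measure_mult_disjoint_le)
    have "compact P" "compact Q"
      using that compact assms by auto
    then show "compact (f ` P)" "compact (g ` Q)"
      using that by (auto intro!: compact_continuous_image continuous_intros)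
    show "f ` P \<subseteq> {0..1}" "g ` Q \<subseteq> {0..1}"
      using that by (auto simp: missing_lines_def unit_square_def)
  qed (use that in auto)
  have cover: "(a, b, c) \<in> A \<or> (a, b, c) \<in> B"
    if "a \<in> {0..1}" "b \<in> {0..1}" "c \<in> {0..1}" for a b c
    using that assms(3) unfolding unit_cube_def by blast
  have mem: "(a, b) \<in> missing_lines exy C \<longleftrightarrow>
        a \<in> {0..1} \<and> b \<in> {0..1} \<and> (\<forall>c \<in> {0..1}. (a, b, c) \<notin> C)"
      "(b, c) \<in> missing_lines eyz C \<longleftrightarrow>
        b \<in> {0..1} \<and> c \<in> {0..1} \<and> (\<forall>a \<in> {0..1}. (a, b, c) \<notin> C)"
      "(a, c) \<in> missing_lines exz C \<longleftrightarrow>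
        a \<in> {0..1} \<and> c \<in> {0..1} \<and> (\<forall>b \<in> {0..1}. (a, b, c) \<notin> C)" for a b c C
    by (auto simp: missing_lines_def unit_square_def e_defs)
  \<comment> \<open>Two different directions share exactly one shadow axis. If \<open>a\<close> lay
    in both shadows, a line over some \<open>(a, b)\<close> missing \<open>A\<close> would meet a
    line over some \<open>(a, c)\<close> missing \<open>B\<close> at \<open>(a, b, c)\<close>, which
    \<open>cover\<close> forbids. The other five bounds are analogous: two for each axis, each
    shadow used once.\<close>
  have s1: "x (missing_lines exy A) * x (missing_lines exz B) \<le> 1 / 4"
    unfolding x_def
    by (rule small)
       (simp, simp, simp, simp, use cover in \<open>auto simp: mem simp del: atLeastAtMost_iff; blast\<close>)
  have s2: "x (missing_lines exz A) * x (missing_lines exy B) \<le> 1 / 4"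
    unfolding x_def
    by (rule small)
       (simp, simp, simp, simp, use cover in \<open>auto simp: mem simp del: atLeastAtMost_iff; blast\<close>)
  have s3: "y (missing_lines exy A) * x (missing_lines eyz B) \<le> 1 / 4"
    unfolding x_def y_def
    by (rule small)
       (simp, simp, simp, simp, use cover in \<open>auto simp: mem simp del: atLeastAtMost_iff; blast\<close>)
  have s4: "x (missing_lines eyz A) * y (missing_lines exy B) \<le> 1 / 4"
    unfolding x_def y_def
    by (rule small)
       (simp, simp, simp, simp, use cover in \<open>auto simp: mem simp del: atLeastAtMost_iff; blast\<close>)
  have s5: "y (missing_lines eyz A) * y (missing_lines exz B) \<le> 1 / 4"
    unfolding y_def
    by (rule small)
       (simp, simp, simp, simp, use cover in \<open>auto simp: mem simp del: atLeastAtMost_iff; blast\<close>)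
  have s6: "y (missing_lines exz A) * y (missing_lines eyz B) \<le> 1 / 4"
    unfolding y_def
    by (rule small)
       (simp, simp, simp, simp, use cover in \<open>auto simp: mem simp del: atLeastAtMost_iff; blast\<close>)
  have nonneg: "0 \<le> x P" "0 \<le> y P" for P
    by (simp_all add: x_def y_def)
  define w where "w e C = x (missing_lines e C) * y (missing_lines e C)"
    for e and C :: "(real \<times> real \<times> real) set"
  have w_big: "1 / 4 < w e C" if "e \<in> {exy, eyz, exz}" "C \<in> {A, B}" for e C
    unfolding w_def using that by (rule big)
  have w_pos: "0 < w e C" if "e \<in> {exy, eyz, exz}" "C \<in> {A, B}" for e C
    using w_big[OF that] by simp
  have "(1 / 4) * (1 / 4) * (1 / 4) * ((1 / 4) * (1 / 4) * (1 / 4))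
      < w exy A * w eyz A * w exz A * (w exy B * w eyz B * w exz B)"
    by (intro mult_strict_mono w_big mult_pos_pos w_pos) simp_all
  \<comment> \<open>The same twelve factors, grouped by direction and set in \<open>w\<close>, are
    regrouped into the six disjoint pairs.\<close>
  also have "\<dots> = (x (missing_lines exy A) * x (missing_lines exz B)) *
      (x (missing_lines exz A) * x (missing_lines exy B)) *
      (y (missing_lines exy A) * x (missing_lines eyz B)) *
      ((x (missing_lines eyz A) * y (missing_lines exy B)) *
      (y (missing_lines eyz A) * y (missing_lines exz B)) *
      (y (missing_lines exz A) * y (missing_lines eyz B)))"
    unfolding w_def by (simp only: mult_ac)
  also have "\<dots> \<le> (1 / 4) * (1 / 4) * (1 / 4) * ((1 / 4) * (1 / 4) * (1 / 4))"
    by (intro mult_mono s1 s2 s3 s4 s5 s6) (auto simp: nonneg)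
  finally show False
    by simp
qed

end
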